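(* Let $\mathcal{F}$ be a class of $n$-variate Boolean functions that is closed under restrictions, let $1\le k\le n$, and let $f\in\mathcal{F}$. Then for all $c\in(0,1)$, \[ \max_{\mathbf{x}\in[-c,c]^n}\bigl|f_{\geq k}(\mathbf{x})\bigr|\le\left(\frac{c}{1-c}\right)^k M_k(\mathcal{F}). \] In particular, $\varepsilon_{c,k}(\mathcal{F})\le\left(\frac{c}{1-c}\right)^k M_k(\mathcal{F})$.
   Context: An $n$-variate Boolean function is $f:\{-1,1\}^n\to\{-1,1\}$; it has a unique multilinear (Fourier) expansion $f(\mathbf{x})=\sum_{S\subseteq[n]}\hat f(S)\mathbf{x}^S$ with $\mathbf{x}^S=\prod_{i\in S}x_i$, and $f$ is identified with this multilinear polynomial on $\mathbb{R}^n$. A class is closed under restrictions if fixing any subset of the input variables to values in $\{-1,1\}$ yields a function that is again in the class. For a multilinear polynomial $f$, $f_k(\mathbf{x})=\sum_{|S|=k}\hat f(S)\mathbf{x}^S$ and $f_{\geq k}=\sum_{i=k}^n f_i$. The level-$k$ absolute Fourier sum is $M_k(f)=\max_{\mathbf{x}\in[-1,1]^n}|f_k(\mathbf{x})|$ and $M_k(\mathcal{F})=\max_{f\in\mathcal{F}}M_k(f)$. For $c\ge 0$, $\varepsilon_{c,k}(f)=\inf_{g:\deg(g)<k}\max_{\mathbf{x}\in[-c,c]^n}|f(\mathbf{x})-g(\mathbf{x})|$ (infimum over polynomials $g$ of degree less than $k$), and $\varepsilon_{c,k}(\mathcal{F})=\max_{f\in\mathcal{F}}\varepsilon_{c,k}(f)$.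 *)

theory Defs
  imports "HOL-Analysis.Analysis"
begin

section \<open>Boolean functions\<close>

text \<open>The variables are indexed by a finite type \<open>'n\<close>, so that $n$ is \<open>CARD('n)\<close>. Functions on
  the discrete cube are extensional, i.e. \<open>undefined\<close> outside of it; two of them are equal
  iff they agree on the cube.\<close>

definition cube :: "(real^'n) set" where
  "cube = {x. \<forall>i. x $ i \<in> {-1, 1}}"

definition boolean_functions :: "(real^'n \<Rightarrow> real) set" where
  "boolean_functions = cube \<rightarrow>\<^sub>E {-1, 1}"

text \<open>The restriction that fixes the variables in \<open>J\<close> according to \<open>z\<close>. It is kept as an
  \<open>n\<close>-variate function, which does not depend on the variables in \<open>J\<close>.\<close>

definition restrict_vars :: "'n set \<Rightarrow> real^'n \<Rightarrow> (real^'n \<Rightarrow> real) \<Rightarrow> real^'n \<Rightarrow> real" where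
  "restrict_vars J z f = (\<lambda>x\<in>cube. f (\<chi> i. if i \<in> J then z $ i else x $ i))"

definition closed_under_restrictions :: "(real^'n \<Rightarrow> real) set \<Rightarrow> bool" where
  "closed_under_restrictions F \<longleftrightarrow> (\<forall>f\<in>F. \<forall>J. \<forall>z\<in>cube. restrict_vars J z f \<in> F)"


section \<open>Fourier expansion\<close>

definition monom_set :: "'n set \<Rightarrow> real^'n \<Rightarrow> real" where
  "monom_set S x = (\<Prod>i\<in>S. x $ i)"

text \<open>Existence and uniqueness are shown in \<open>fourier_expansion_unique\<close> below.\<close>

definition fourier_coeff :: "(real^'n \<Rightarrow> real) \<Rightarrow> 'n set \<Rightarrow> real" where
  "fourier_coeff f = (THE a. \<forall>x\<in>cube. f x = (\<Sum>S\<in>UNIV. a S * monom_set S x))"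

definition multilinear_ext :: "(real^'n \<Rightarrow> real) \<Rightarrow> real^'n \<Rightarrow> real" where
  "multilinear_ext f x = (\<Sum>S\<in>UNIV. fourier_coeff f S * monom_set S x)"

definition level :: "nat \<Rightarrow> (real^'n \<Rightarrow> real) \<Rightarrow> real^'n \<Rightarrow> real" where
  "level k f x = (\<Sum>S | card S = k. fourier_coeff f S * monom_set S x)"

definition level_ge :: "nat \<Rightarrow> (real^'n \<Rightarrow> real) \<Rightarrow> real^'n \<Rightarrow> real" where
  "level_ge k f x = (\<Sum>i = k..CARD('n). level i f x)"


section \<open>Absolute Fourier sums and approximation errors\<close>

abbreviation box_of :: "real \<Rightarrow> (real^'n) set" where
  "box_of c \<equiv> cbox (vec (- c)) (vec c)"

text \<open>Maxima over boxes are written as suprema. For \<open>c \<ge> 0\<close> they are attained,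
  see \<open>box_max_attained\<close>.\<close>

definition fourier_sum :: "nat \<Rightarrow> (real^'n \<Rightarrow> real) \<Rightarrow> real" where
  "fourier_sum k f = (SUP x \<in> box_of 1. \<bar>level k f x\<bar>)"

definition fourier_sum_class :: "nat \<Rightarrow> (real^'n \<Rightarrow> real) set \<Rightarrow> real" where
  "fourier_sum_class k F = Max (fourier_sum k ` F)"

definition polys_degree_less :: "nat \<Rightarrow> (real^'n \<Rightarrow> real) set" where
  "polys_degree_less k =
     {g. \<exists>a :: ('n \<Rightarrow> nat) \<Rightarrow> real.
           \<forall>x. g x = (\<Sum>m | (\<Sum>i\<in>UNIV. m i) < k. a m * (\<Prod>i\<in>UNIV. (x $ i) ^ m i))}"

definition approx_error :: "real \<Rightarrow> nat \<Rightarrow> (real^'n \<Rightarrow> real) \<Rightarrow> real" where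
  "approx_error c k f =
     (INF g \<in> polys_degree_less k. SUP x \<in> box_of c. \<bar>multilinear_ext f x - g x\<bar>)"

definition approx_error_class :: "real \<Rightarrow> nat \<Rightarrow> (real^'n \<Rightarrow> real) set \<Rightarrow> real" where
  "approx_error_class c k F = Max (approx_error c k ` F)"


section \<open>Well-definedness\<close>

lemma cube_eq_image: "(cube :: (real^'n) set) = vec_lambda ` (UNIV \<rightarrow>\<^sub>E {-1, 1})"
proof -
  have "x \<in> vec_lambda ` (UNIV \<rightarrow>\<^sub>E {-1, 1})" if "x \<in> cube" for x :: "real^'n"
  proof -
    have "x = vec_lambda (\<lambda>i. x $ i)" by simp
    moreover have "(\<lambda>i. x $ i) \<in> UNIV \<rightarrow>\<^sub>E {-1, 1}"
      using that by (auto simp: cube_def)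
    ultimately show ?thesis by blast
  qed
  then show ?thesis by (auto simp: cube_def PiE_def Pi_def)
qed

lemma finite_cube: "finite (cube :: (real^'n) set)"
  unfolding cube_eq_image by (intro finite_imageI finite_PiE) auto

lemma finite_boolean_functions: "finite (boolean_functions :: (real^'n \<Rightarrow> real) set)"
  unfolding boolean_functions_def by (intro finite_PiE finite_cube) auto

lemma restrict_vars_boolean:
  assumes "f \<in> boolean_functions" "z \<in> cube"
  shows "restrict_vars J z f \<in> boolean_functions"
proof -
  have "(\<chi> i. if i \<in> J then z $ i else x $ i) \<in> cube" if "x \<in> cube" for x
    using that assms(2) by (simp add: cube_def)
  then show ?thesis
    using assms(1) by (auto simp: boolean_functions_def restrict_vars_def PiE_iff)
qed

lemma sum_monom_set_eq_0:
  fixes S :: "'n::finite set"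
  assumes "S \<noteq> {}"
  shows "(\<Sum>x\<in>cube. monom_set S x) = 0"
proof -
  obtain j where j: "j \<in> S" using assms by blast
  define flip :: "real^'n \<Rightarrow> real^'n" where "flip x = (\<chi> i. if i = j then - x $ i else x $ i)" for x
  have flip2: "flip (flip x) = x" for x by (simp add: flip_def vec_eq_iff)
  have bij: "bij_betw flip cube cube"
    by (rule bij_betwI[where g = flip]) (auto simp: flip2, auto simp: flip_def cube_def)
  have neg: "monom_set S (flip x) = - monom_set S x" for x
  proof -
    have "(\<Prod>i\<in>S - {j}. flip x $ i) = (\<Prod>i\<in>S - {j}. x $ i)"
      by (rule prod.cong) (auto simp: flip_def)
    then show ?thesis
      using j by (simp add: monom_set_def prod.remove[of S j] flip_def)
  qed
  have "(\<Sum>x\<in>cube. monom_set S x) = (\<Sum>x\<in>cube. monom_set S (flip x))"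
    by (rule sum.reindex_bij_betw[OF bij, symmetric])
  also have "\<dots> = - (\<Sum>x\<in>cube. monom_set S x)"
    by (simp add: neg sum_negf)
  finally show ?thesis by simp
qed

lemma cube_square: "x \<in> cube \<Longrightarrow> x $ i * x $ i = 1"
proof -
  assume "x \<in> cube"
  then have "x $ i \<in> {-1, 1}" by (simp add: cube_def)
  then show ?thesis by auto
qed

lemma monom_set_mult:
  assumes "x \<in> cube"
  shows "monom_set S x * monom_set T x = monom_set (S - T \<union> (T - S)) x"
proof -
  have sq: "x $ i * x $ i = 1" for i
    using assms by (rule cube_square)
  have split: "monom_set A x = monom_set (A - B) x * monom_set (A \<inter> B) x" for A B
    unfolding monom_set_def using prod.Int_Diff[of A "\<lambda>i. x $ i" B] by (simp add: mult.commute)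
  have "monom_set S x * monom_set T x =
          monom_set (S - T) x * monom_set (T - S) x * (monom_set (S \<inter> T) x * monom_set (S \<inter> T) x)"
    by (simp add: split[of S T] split[of T S] Int_commute mult_ac)
  moreover have "monom_set (S \<inter> T) x * monom_set (S \<inter> T) x = 1"
    by (simp add: monom_set_def prod.distrib[symmetric] sq)
  moreover have "monom_set (S - T \<union> (T - S)) x = monom_set (S - T) x * monom_set (T - S) x"
    unfolding monom_set_def by (rule prod.union_disjoint) auto
  ultimately show ?thesis by simp
qed

lemma monom_set_orthogonal:
  fixes S T :: "'n::finite set"
  shows "(\<Sum>x\<in>cube. monom_set S x * monom_set T x) =
           (if S = T then real (card (cube :: (real^'n) set)) else 0)"
proof -
  have "(\<Sum>x\<in>cube. monom_set S x * monom_set T x) =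
          (\<Sum>x\<in>cube. monom_set (S - T \<union> (T - S)) x)"
    by (rule sum.cong) (auto simp: monom_set_mult)
  moreover have "S - T \<union> (T - S) = {} \<longleftrightarrow> S = T" by blast
  ultimately show ?thesis
    by (cases "S = T") (simp_all add: sum_monom_set_eq_0, simp add: monom_set_def)
qed

lemma indicator_expansion:
  fixes x y :: "real^'n"
  assumes "x \<in> cube" "y \<in> cube"
  shows "(\<Sum>S\<in>UNIV. monom_set S x * monom_set S y) = (if x = y then 2 ^ CARD('n) else 0)"
proof -
  have "(\<Sum>S\<in>UNIV. monom_set S x * monom_set S y) = (\<Sum>S\<in>Pow UNIV. \<Prod>i\<in>S. x $ i * y $ i)"
    by (simp add: monom_set_def prod.distrib)
  also have "\<dots> = (\<Prod>i\<in>UNIV. x $ i * y $ i + 1)"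
    by (subst prod_add) auto
  also have "\<dots> = (if x = y then 2 ^ CARD('n) else 0)"
  proof (cases "x = y")
    case True
    then have "x $ i * y $ i = 1" for i using assms by (simp add: cube_square)
    then show ?thesis using True by simp
  next
    case False
    then obtain i where i: "x $ i \<noteq> y $ i" by (auto simp: vec_eq_iff)
    have "x $ i \<in> {-1, 1}" "y $ i \<in> {-1, 1}"
      using assms by (simp_all add: cube_def)
    with i have "x $ i * y $ i + 1 = 0" by auto
    then show ?thesis using False by (auto intro!: prod_zero)
  qed
  finally show ?thesis .
qed

theorem fourier_expansion_unique:
  fixes f :: "real^'n \<Rightarrow> real"
  shows "\<exists>!a. \<forall>x\<in>cube. f x = (\<Sum>S\<in>UNIV. a S * monom_set S x)"
proof (rule ex_ex1I)
  define a where "a S = (\<Sum>y\<in>cube. f y * monom_set S y) / 2 ^ CARD('n)" for S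
  have "f x = (\<Sum>S\<in>UNIV. a S * monom_set S x)" if "x \<in> cube" for x
  proof -
    have "(\<Sum>S\<in>UNIV. a S * monom_set S x) =
            (\<Sum>S\<in>UNIV. \<Sum>y\<in>cube. f y * (monom_set S x * monom_set S y)) / 2 ^ CARD('n)"
      by (simp add: a_def sum_distrib_left sum_distrib_right sum_divide_distrib mult_ac)
    also have "(\<Sum>S\<in>UNIV. \<Sum>y\<in>cube. f y * (monom_set S x * monom_set S y)) =
                 (\<Sum>y\<in>cube. f y * (\<Sum>S\<in>UNIV. monom_set S x * monom_set S y))"
      by (subst sum.swap) (simp add: sum_distrib_left)
    also have "\<dots> = (\<Sum>y\<in>cube. if x = y then f y * 2 ^ CARD('n) else 0)"
      by (rule sum.cong) (auto simp: indicator_expansion that)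
    also have "\<dots> = f x * 2 ^ CARD('n)"
      using that by (simp add: finite_cube)
    finally show ?thesis by simp
  qed
  then show "\<exists>a. \<forall>x\<in>cube. f x = (\<Sum>S\<in>UNIV. a S * monom_set S x)" by blast
next
  fix a b :: "'n set \<Rightarrow> real"
  assume a: "\<forall>x\<in>cube. f x = (\<Sum>S\<in>UNIV. a S * monom_set S x)"
    and b: "\<forall>x\<in>cube. f x = (\<Sum>S\<in>UNIV. b S * monom_set S x)"
  have ne: "card (cube :: (real^'n) set) \<noteq> 0"
  proof -
    have "(1 :: real^'n) \<in> cube" by (simp add: cube_def)
    then show ?thesis using finite_cube[where 'n = 'n] by (metis card_0_eq empty_iff)
  qed
  have coeff: "(\<Sum>x\<in>cube. f x * monom_set T x) = d T * real (card (cube :: (real^'n) set))"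
    if "\<forall>x\<in>cube. f x = (\<Sum>S\<in>UNIV. d S * monom_set S x)" for d T
  proof -
    have "(\<Sum>x\<in>cube. f x * monom_set T x) =
            (\<Sum>x\<in>cube. \<Sum>S\<in>UNIV. d S * (monom_set S x * monom_set T x))"
      by (rule sum.cong) (auto simp: that sum_distrib_right mult.assoc)
    also have "\<dots> = (\<Sum>S\<in>UNIV. d S * (\<Sum>x\<in>cube. monom_set S x * monom_set T x))"
      by (subst sum.swap) (simp add: sum_distrib_left)
    also have "\<dots> = (\<Sum>S\<in>UNIV. if S = T then d S * real (card (cube :: (real^'n) set)) else 0)"
      by (rule sum.cong) (auto simp: monom_set_orthogonal)
    finally show ?thesis by simp
  qed
  show "a = b"
    using coeff[OF a] coeff[OF b] ne by (auto simp: fun_eq_iff)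
qed

corollary multilinear_ext_eq:
  "x \<in> cube \<Longrightarrow> multilinear_ext f x = f x"
  using theI'[OF fourier_expansion_unique[of f]]
  by (simp add: multilinear_ext_def fourier_coeff_def)

lemma box_max_attained:
  fixes h :: "real^'n \<Rightarrow> real"
  assumes "c \<ge> 0" "continuous_on (box_of c) h"
  shows "\<exists>x\<in>box_of c. (SUP y\<in>box_of c. \<bar>h y\<bar>) = \<bar>h x\<bar> \<and> (\<forall>y\<in>box_of c. \<bar>h y\<bar> \<le> \<bar>h x\<bar>)"
proof -
  have "vec 0 \<in> (box_of c :: (real^'n) set)"
    using assms(1) by (simp add: mem_box_cart)
  then have "(box_of c :: (real^'n) set) \<noteq> {}" by blast
  then obtain x where x: "x \<in> box_of c" "\<forall>y\<in>box_of c. \<bar>h y\<bar> \<le> \<bar>h x\<bar>"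
    using continuous_attains_sup[OF compact_cbox _ continuous_on_rabs[OF assms(2)]] by blast
  then have "(SUP y\<in>box_of c. \<bar>h y\<bar>) = \<bar>h x\<bar>"
    by (intro cSup_eq_maximum) auto
  then show ?thesis using x by blast
qed

lemma continuous_on_level: "continuous_on A (level k f)"
  unfolding level_def monom_set_def by (intro continuous_intros)

lemma continuous_on_level_ge: "continuous_on A (level_ge k f)"
  unfolding level_ge_def by (intro continuous_intros continuous_on_level)

lemma continuous_on_multilinear_ext: "continuous_on A (multilinear_ext f)"
  unfolding multilinear_ext_def monom_set_def by (intro continuous_intros)

lemma continuous_on_poly:
  assumes "g \<in> polys_degree_less k"
  shows "continuous_on A g"
proof -
  obtain a where "g = (\<lambda>x. \<Sum>m | (\<Sum>i\<in>UNIV. m i) < k. a m * (\<Prod>i\<in>UNIV. (x $ i) ^ m i))"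
    using assms by (auto simp: polys_degree_less_def fun_eq_iff)
  then show ?thesis by (simp only:) (intro continuous_intros)
qed

lemma finite_exponents: "finite {m :: 'n::finite \<Rightarrow> nat. (\<Sum>i\<in>UNIV. m i) < k}"
proof (rule finite_subset)
  show "{m :: 'n \<Rightarrow> nat. (\<Sum>i\<in>UNIV. m i) < k} \<subseteq> UNIV \<rightarrow>\<^sub>E {..<k}"
  proof safe
    fix m :: "'n \<Rightarrow> nat" and i assume "(\<Sum>i\<in>UNIV. m i) < k"
    moreover have "m i \<le> (\<Sum>i\<in>UNIV. m i)" by (rule member_le_sum) auto
    ultimately show "m i < k" by linarith
  qed auto
  show "finite ((UNIV :: 'n set) \<rightarrow>\<^sub>E {..<k})"
    by (intro finite_PiE) auto
qed

end

theory Submission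
  imports Defs
begin

text \<open>Fix \<open>y\<close> and put \<open>h t = f (t y)\<close>, so that \<open>f\<^sub>\<ge>\<^sub>k (c y)\<close> is the remainder of order \<open>k\<close> in the
  Taylor expansion of \<open>h\<close>. By Lagrange it equals \<open>c\<^sup>k h\<^sup>(\<^sup>k\<^sup>)(s) / k!\<close> for some \<open>0 < s < c\<close>. If \<open>y\<close> is
  a vertex of the cube and each variable is independently fixed to its value in \<open>y\<close> with probability
  \<open>s\<close>, then the expected level-\<open>k\<close> part of the restricted function at \<open>y\<close> is
  \<open>(1 - s)\<^sup>k h\<^sup>(\<^sup>k\<^sup>)(s) / k!\<close>, so this is at most \<open>M\<^sub>k\<close> in absolute value. By multilinearity the
  bound extends from the vertices to all \<open>y\<close> in the solid cube.\<close>

section \<open>Levels of the Fourier expansion\<close>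

lemma fourier_coeff_eqI:
  assumes "\<And>x. x \<in> cube \<Longrightarrow> f x = (\<Sum>S\<in>UNIV. a S * monom_set S x)"
  shows "fourier_coeff f = a"
  unfolding fourier_coeff_def
  by (rule the1_equality[OF fourier_expansion_unique]) (use assms in blast)

lemma monom_set_merge:
  "monom_set S (\<chi> i. if i \<in> J then z $ i else x $ i) = monom_set (S \<inter> J) z * monom_set (S - J) x"
  unfolding monom_set_def
  by (subst prod.Int_Diff[of S _ J]) (auto intro!: arg_cong2[where f = "(*)"] prod.cong)

lemma monom_set_scaleR: "monom_set S (t *\<^sub>R x) = t ^ card S * monom_set S x"
  by (simp add: monom_set_def prod.distrib)

lemma level_scaleR: "level k f (t *\<^sub>R x) = t ^ k * level k f x"
  by (simp add: level_def monom_set_scaleR sum_distrib_left mult_ac)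

text \<open>A weight that depends only on the level turns the level sum into a multilinear
  polynomial with rescaled coefficients. In that form the passage from vertices to the solid cube
  applies.\<close>

lemma sum_level:
  fixes f :: "real^'n \<Rightarrow> real"
  shows "(\<Sum>i\<le>CARD('n). w i * level i f x)
       = (\<Sum>S\<in>UNIV. w (card S) * (fourier_coeff f S * monom_set S x))"
proof -
  have "(\<Sum>i\<le>CARD('n). w i * level i f x)
      = (\<Sum>i\<le>CARD('n). \<Sum>S | S \<in> UNIV \<and> card S = i. w (card S) * (fourier_coeff f S * monom_set S x))"
    by (simp add: level_def sum_distrib_left)
  also have "\<dots> = (\<Sum>S\<in>UNIV. w (card S) * (fourier_coeff f S * monom_set S x))"
    by (rule sum.group) (auto intro: card_mono)
  finally show ?thesis .
qed

lemma multilinear_ext_eq_levels: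
  fixes f :: "real^'n \<Rightarrow> real"
  assumes "k \<le> CARD('n)"
  shows "multilinear_ext f x = (\<Sum>i<k. level i f x) + level_ge k f x"
proof -
  have "multilinear_ext f x = (\<Sum>i\<le>CARD('n). level i f x)"
    using sum_level[of "\<lambda>_. 1" f x] by (simp add: multilinear_ext_def)
  also have "{..CARD('n)} = {..<k} \<union> {k..CARD('n)}"
    using assms by auto
  also have "(\<Sum>i\<in>\<dots>. level i f x) = (\<Sum>i<k. level i f x) + level_ge k f x"
    unfolding level_ge_def by (rule sum.union_disjoint) auto
  finally show ?thesis .
qed

section \<open>Restrictions, random restrictions and averaging over vertices\<close>

lemma level_restrict_vars:
  assumes z: "z \<in> cube"
  shows "level k (restrict_vars J z f) x
       = (\<Sum>S | card (S - J) = k. fourier_coeff f S * (monom_set (S \<inter> J) z * monom_set (S - J) x))"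
proof -
  \<comment> \<open>Fixing \<open>J\<close> turns the monomial of \<open>S\<close> into a constant
    times the monomial of \<open>S - J\<close>, so the new coefficient of \<open>T\<close> collects
    all \<open>S\<close> with \<open>S - J = T\<close>. By uniqueness of the expansion these are the
    Fourier coefficients of the restriction.\<close>
  define a where "a T = (\<Sum>S | S - J = T. fourier_coeff f S * monom_set (S \<inter> J) z)" for T
  have group: "(\<Sum>T\<in>A. a T * monom_set T u)
      = (\<Sum>S | S - J \<in> A. fourier_coeff f S * (monom_set (S \<inter> J) z * monom_set (S - J) u))" for A u
  proof -
    have "(\<Sum>T\<in>A. a T * monom_set T u)
        = (\<Sum>T\<in>A. \<Sum>S | S \<in> {S. S - J \<in> A} \<and> S - J = T.
             fourier_coeff f S * (monom_set (S \<inter> J) z * monom_set (S - J) u))"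
      unfolding a_def sum_distrib_right by (intro sum.cong) (auto simp: mult_ac)
    also have "\<dots> = (\<Sum>S | S - J \<in> A. fourier_coeff f S * (monom_set (S \<inter> J) z * monom_set (S - J) u))"
      by (rule sum.group) auto
    finally show ?thesis .
  qed
  have "restrict_vars J z f u = (\<Sum>T\<in>UNIV. a T * monom_set T u)" if u: "u \<in> cube" for u
  proof -
    have "(\<chi> i. if i \<in> J then z $ i else u $ i) \<in> cube"
      using u z by (simp add: cube_def)
    then have "restrict_vars J z f u = multilinear_ext f (\<chi> i. if i \<in> J then z $ i else u $ i)"
      using u by (simp add: restrict_vars_def multilinear_ext_eq)
    then show ?thesis
      by (simp add: multilinear_ext_def monom_set_merge group)
  qed
  then have "fourier_coeff (restrict_vars J z f) = a"
    by (rule fourier_coeff_eqI)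
  then show ?thesis
    using group[where A = "{T. card T = k}" and u = x] by (simp add: level_def)
qed

text \<open>When \<open>z\<close> is both the assignment and the evaluation point, the two factors
  of each monomial recombine. So a term of \<open>f\<close> survives unchanged exactly when
  \<open>k\<close> of its variables remain free.\<close>

lemma level_restrict_vars_same:
  assumes "z \<in> cube"
  shows "level k (restrict_vars J z f) z
       = (\<Sum>S | card (S - J) = k. fourier_coeff f S * monom_set S z)"
proof -
  have "monom_set (S \<inter> J) z * monom_set (S - J) z = monom_set S z" for S
    unfolding monom_set_def by (rule prod.Int_Diff[symmetric]) simp
  then show ?thesis
    using assms by (simp add: level_restrict_vars)
qed

lemma sum_Pow_power:
  fixes s :: real
  assumes "finite A"
  shows "(\<Sum>B\<in>Pow A. s ^ card B * (1 - s) ^ card (A - B)) = 1"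
  using prod_add[OF assms, of "\<lambda>_. s" "\<lambda>_. 1 - s"] by simp

text \<open>If each variable is put into \<open>J\<close> independently with probability
  \<open>s\<close>, the left side is the probability that exactly \<open>k\<close> elements of
  \<open>S\<close> stay outside \<open>J\<close>, a binomial probability. For
  \<open>card S < k\<close> both sides are 0.\<close>

lemma sum_subsets_card_Diff:
  fixes s :: real and S :: "'n::finite set"
  shows "(\<Sum>J | card (S - J) = k. s ^ card J * (1 - s) ^ card (- J))
       = real (card S choose k) * (1 - s) ^ k * s ^ (card S - k)"
proof -
  let ?P = "{A. A \<subseteq> S \<and> card (S - A) = k}"
  have "(\<Sum>J | card (S - J) = k. s ^ card J * (1 - s) ^ card (- J))
      = (\<Sum>(A, B) \<in> ?P \<times> Pow (- S).
          (s ^ card A * (1 - s) ^ card (S - A)) * (s ^ card B * (1 - s) ^ card (- S - B)))"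
  \<comment> \<open>\<open>J\<close> splits into its independent parts inside and outside
    \<open>S\<close>. The outside part is unconstrained, so its weights sum to 1.\<close>
  proof (rule sum.reindex_bij_witness[where i = "\<lambda>(A, B). A \<union> B" and j = "\<lambda>J. (J \<inter> S, J - S)"])
    fix J assume J: "J \<in> {J. card (S - J) = k}"
    have "card J = card (J \<inter> S) + card (J - S)"
      by (subst card_Un_disjoint[symmetric]) (auto intro: arg_cong[where f = card])
    moreover have "card (- J) = card (S - J \<inter> S) + card (- S - (J - S))"
      by (subst card_Un_disjoint[symmetric]) (auto intro: arg_cong[where f = card])
    ultimately show "(case (J \<inter> S, J - S) of (A, B) \<Rightarrow>
        (s ^ card A * (1 - s) ^ card (S - A)) * (s ^ card B * (1 - s) ^ card (- S - B)))
      = s ^ card J * (1 - s) ^ card (- J)"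
      by (simp add: power_add mult_ac)
    have "S - J \<inter> S = S - J" by blast
    then show "(J \<inter> S, J - S) \<in> ?P \<times> Pow (- S)" using J by auto
  next
    fix p assume p: "p \<in> ?P \<times> Pow (- S)"
    then have "S - (fst p \<union> snd p) = S - fst p" by auto
    then show "(case p of (A, B) \<Rightarrow> A \<union> B) \<in> {J. card (S - J) = k}"
      using p by (auto simp: case_prod_beta)
  qed auto
  also have "\<dots> = (\<Sum>A\<in>?P. s ^ card A * (1 - s) ^ card (S - A))
                  * (\<Sum>B\<in>Pow (- S). s ^ card B * (1 - s) ^ card (- S - B))"
    by (simp only: sum_product sum.cartesian_product)
  also have "\<dots> = (\<Sum>A\<in>?P. s ^ card A * (1 - s) ^ card (S - A))"
    by (simp add: sum_Pow_power)
  also have "\<dots> = (\<Sum>A\<in>?P. (1 - s) ^ k * s ^ (card S - k))"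
  proof (rule sum.cong)
    fix A assume A: "A \<in> ?P"
    then have "card (S - A) = card S - card A" "card A \<le> card S"
      by (auto intro: card_Diff_subset card_mono)
    then have "card A = card S - k" using A by auto
    then show "s ^ card A * (1 - s) ^ card (S - A) = (1 - s) ^ k * s ^ (card S - k)"
      using A by simp
  qed simp
  \<comment> \<open>Complementation within \<open>S\<close> is an involution that exchanges the two
    families.\<close>
  also have "card ?P = card {B. B \<subseteq> S \<and> card B = k}"
    by (rule bij_betw_same_card[of "\<lambda>A. S - A"], rule bij_betwI[where g = "\<lambda>A. S - A"])
       (auto simp: double_diff)
  then have "(\<Sum>A\<in>?P. (1 - s) ^ k * s ^ (card S - k))
      = real (card S choose k) * (1 - s) ^ k * s ^ (card S - k)"
    by (simp add: n_subsets)
  finally show ?thesis .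
qed

text \<open>Every point of the solid cube is the mean of the product distribution on the vertices with
  density proportional to \<open>\<Prod>i. 1 + v\<^sub>i x\<^sub>i\<close>.\<close>

lemma multilinear_bound_from_cube:
  fixes b :: "'n::finite set \<Rightarrow> real"
  assumes bound: "\<And>v. v \<in> cube \<Longrightarrow> \<bar>\<Sum>S\<in>UNIV. b S * monom_set S v\<bar> \<le> M"
    and x: "x \<in> box_of 1"
  shows "\<bar>\<Sum>S\<in>UNIV. b S * monom_set S x\<bar> \<le> M"
proof -
  define N where "N = real (card (cube :: (real^'n) set))"
  define w where "w v = (\<Prod>i\<in>UNIV. 1 + v $ i * x $ i) / N" for v :: "real^'n"
  have "(1 :: real^'n) \<in> cube" by (simp add: cube_def)
  then have N: "N > 0"
    using finite_cube[where 'n = 'n] by (auto simp: N_def card_gt_0_iff)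
  have w_nonneg: "w v \<ge> 0" if "v \<in> cube" for v
  proof -
    have "1 + v $ i * x $ i \<ge> 0" for i
    proof -
      have "v $ i \<in> {-1, 1}" using that by (simp add: cube_def)
      moreover have "-1 \<le> x $ i" "x $ i \<le> 1" using x by (simp_all add: mem_box_cart)
      ultimately show ?thesis by auto
    qed
    then show ?thesis using N by (simp add: w_def prod_nonneg)
  qed
  have w_alt: "w v = (\<Sum>T\<in>UNIV. monom_set T v * monom_set T x) / N" for v
  proof -
    have "(\<Prod>i\<in>UNIV. v $ i * x $ i + 1) = (\<Sum>T\<in>Pow UNIV. \<Prod>i\<in>T. v $ i * x $ i)"
      by (subst prod_add) auto
    then show ?thesis
      by (simp add: w_def monom_set_def prod.distrib add.commute)
  qed
  \<comment> \<open>The expanded density acts as a reproducing kernel: by orthogonality only the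
    term \<open>T = S\<close> survives the sum over the vertices.\<close>
  have mean: "(\<Sum>v\<in>cube. w v * monom_set S v) = monom_set S x" for S
  proof -
    have "(\<Sum>v\<in>cube. w v * monom_set S v)
        = (\<Sum>v\<in>cube. \<Sum>T\<in>UNIV. monom_set T x * (monom_set T v * monom_set S v)) / N"
      by (simp add: w_alt sum_distrib_left sum_distrib_right sum_divide_distrib mult_ac)
    also have "(\<Sum>v\<in>cube. \<Sum>T\<in>UNIV. monom_set T x * (monom_set T v * monom_set S v))
        = (\<Sum>T\<in>UNIV. monom_set T x * (\<Sum>v\<in>cube. monom_set T v * monom_set S v))"
      by (subst sum.swap) (simp add: sum_distrib_left)
    also have "\<dots> = (\<Sum>T\<in>UNIV. if T = S then monom_set T x * N else 0)"
      by (rule sum.cong) (auto simp: monom_set_orthogonal N_def)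
    also have "\<dots> = monom_set S x * N"
      by simp
    finally show ?thesis using N by simp
  qed
  \<comment> \<open>The empty monomial is the constant 1, so its mean is the total mass.\<close>
  have w_sum: "(\<Sum>v\<in>cube. w v) = 1"
    using mean[of "{}"] by (simp add: monom_set_def)
  have "(\<Sum>S\<in>UNIV. b S * monom_set S x) = (\<Sum>S\<in>UNIV. \<Sum>v\<in>cube. w v * (b S * monom_set S v))"
    by (simp add: mean[symmetric] sum_distrib_left mult_ac)
  also have "\<dots> = (\<Sum>v\<in>cube. w v * (\<Sum>S\<in>UNIV. b S * monom_set S v))"
    by (subst sum.swap) (simp add: sum_distrib_left)
  also have "\<bar>\<dots>\<bar> \<le> (\<Sum>v\<in>cube. \<bar>w v * (\<Sum>S\<in>UNIV. b S * monom_set S v)\<bar>)"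
    by (rule sum_abs)
  also have "\<dots> \<le> (\<Sum>v\<in>cube. w v * M)"
    using bound w_nonneg by (intro sum_mono) (simp add: abs_mult mult_left_mono)
  also have "\<dots> = M"
    by (simp add: sum_distrib_right[symmetric] w_sum)
  finally show ?thesis .
qed

section \<open>Bounding Taylor coefficients by the level-\<open>k\<close> absolute Fourier
  sum\<close>

lemma abs_level_le_fourier_sum_class:
  fixes F :: "(real^'n \<Rightarrow> real) set"
  assumes "F \<subseteq> boolean_functions" "f \<in> F" "x \<in> box_of 1"
  shows "\<bar>level k f x\<bar> \<le> fourier_sum_class k F"
proof -
  have "finite F"
    using assms(1) finite_boolean_functions by (rule finite_subset)
  then have "fourier_sum k f \<le> fourier_sum_class k F"
    using assms(2) unfolding fourier_sum_class_def by (intro Max_ge) auto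
  moreover have "\<bar>level k f x\<bar> \<le> fourier_sum k f"
    using box_max_attained[of 1 "level k f"] assms(3) continuous_on_level
    unfolding fourier_sum_def by fastforce
  ultimately show ?thesis by linarith
qed

text \<open>The sum is the Taylor coefficient of order \<open>k\<close> at \<open>s\<close> of the
  polynomial t \<mapsto> f(t y). Terms with \<open>i < k\<close> vanish through the binomial
  coefficient, so the truncated exponent \<open>i - k\<close> does no harm there.\<close>

lemma taylor_coeff_bound:
  fixes F :: "(real^'n \<Rightarrow> real) set"
  assumes F: "F \<subseteq> boolean_functions" "closed_under_restrictions F" "f \<in> F"
    and s: "0 \<le> s" "s \<le> 1" and y: "y \<in> box_of 1"
  shows "(1 - s) ^ k * \<bar>\<Sum>i\<le>CARD('n). real (i choose k) * s ^ (i - k) * level i f y\<bar>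
       \<le> fourier_sum_class k F"
proof -
  \<comment> \<open>Each coefficient is multiplied by the probability that exactly \<open>k\<close>
    variables of its monomial remain free.\<close>
  define b where
    "b S = real (card S choose k) * (1 - s) ^ k * s ^ (card S - k) * fourier_coeff f S" for S
  have "\<bar>\<Sum>S\<in>UNIV. b S * monom_set S v\<bar> \<le> fourier_sum_class k F" if v: "v \<in> cube" for v
  proof -
    define p :: "'n set \<Rightarrow> real" where "p J = s ^ card J * (1 - s) ^ card (- J)" for J
    have p_nonneg: "p J \<ge> 0" for J
      using s by (simp add: p_def)
    have p_sum: "(\<Sum>J\<in>UNIV. p J) = 1"
      using sum_Pow_power[of "UNIV :: 'n set" s] by (simp add: p_def Compl_eq_Diff_UNIV)
    have "-1 \<le> v $ i \<and> v $ i \<le> 1" for i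
    proof -
      have "v $ i \<in> {-1, 1}" using v by (simp add: cube_def)
      then show ?thesis by auto
    qed
    then have v_box: "v \<in> box_of 1"
      by (simp add: mem_box_cart)
    have "(\<Sum>S\<in>UNIV. b S * monom_set S v)
        = (\<Sum>S\<in>UNIV. (\<Sum>J | card (S - J) = k. p J) * (fourier_coeff f S * monom_set S v))"
      by (simp add: b_def p_def sum_subsets_card_Diff mult_ac)
    also have "\<dots> = (\<Sum>S\<in>UNIV. \<Sum>J | J \<in> UNIV \<and> card (S - J) = k.
                       p J * (fourier_coeff f S * monom_set S v))"
      by (simp add: sum_distrib_right)
    also have "\<dots> = (\<Sum>J\<in>UNIV. \<Sum>S | S \<in> UNIV \<and> card (S - J) = k.
                       p J * (fourier_coeff f S * monom_set S v))"
      by (rule sum.swap_restrict) auto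
    also have "\<dots> = (\<Sum>J\<in>UNIV. p J * level k (restrict_vars J v f) v)"
      by (simp add: level_restrict_vars_same[OF v] sum_distrib_left)
    also have "\<bar>\<dots>\<bar> \<le> (\<Sum>J\<in>UNIV. \<bar>p J * level k (restrict_vars J v f) v\<bar>)"
      by (rule sum_abs)
    also have "\<dots> \<le> (\<Sum>J\<in>UNIV. p J * fourier_sum_class k F)"
    proof (rule sum_mono)
      fix J
      have "restrict_vars J v f \<in> F"
        using F v by (simp add: closed_under_restrictions_def)
      then show "\<bar>p J * level k (restrict_vars J v f) v\<bar> \<le> p J * fourier_sum_class k F"
        using abs_level_le_fourier_sum_class[OF F(1) _ v_box] p_nonneg
        by (simp add: abs_mult mult_left_mono)
    qed
    also have "\<dots> = fourier_sum_class k F"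
      by (simp add: sum_distrib_right[symmetric] p_sum)
    finally show ?thesis .
  qed
  then have "\<bar>\<Sum>S\<in>UNIV. b S * monom_set S y\<bar> \<le> fourier_sum_class k F"
    using y by (rule multilinear_bound_from_cube)
  moreover have "(\<Sum>S\<in>UNIV. b S * monom_set S y)
      = (1 - s) ^ k * (\<Sum>i\<le>CARD('n). real (i choose k) * s ^ (i - k) * level i f y)"
    using sum_level[of "\<lambda>i. real (i choose k) * s ^ (i - k)" f y]
    by (simp add: b_def sum_distrib_left mult_ac)
  ultimately show ?thesis
    using s by (simp add: abs_mult)
qed

section \<open>Lagrange remainder and the bound on the high levels\<close>

lemma polynomial_Lagrange_remainder:
  fixes a :: "nat \<Rightarrow> real"
  assumes "0 < c" "1 \<le> k" "k \<le> n"
  shows "\<exists>s. 0 < s \<and> s < c \<and>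
    (\<Sum>i=k..n. a i * c ^ i) = (\<Sum>i\<le>n. real (i choose k) * s ^ (i - k) * a i) * c ^ k"
proof -
  \<comment> \<open>\<open>D m\<close> is the derivative of order \<open>m\<close> of the polynomial
    with coefficients \<open>a\<close>; \<open>fact m\<close> times the binomial coefficient is a
    falling factorial, which is 0 for \<open>i < m\<close>.\<close>
  define D where "D m t = (\<Sum>i\<le>n. fact m * real (i choose m) * a i * t ^ (i - m))" for m t
  \<comment> \<open>Both sides are the falling factorial of \<open>i\<close> with
    \<open>Suc m\<close> factors.\<close>
  have coeff: "fact m * real (i choose m) * real (i - m) = fact (Suc m) * real (i choose Suc m)" for i m
  proof -
    have "Suc m * (i choose Suc m) = (i choose m) * (i - m)"
      by (metis binomial_absorption binomial_absorb_comp mult.commute)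
    then have "real (Suc m) * real (i choose Suc m) = real (i choose m) * real (i - m)"
      by (metis of_nat_mult)
    then show ?thesis by (simp add: mult_ac)
  qed
  have deriv: "(D m has_real_derivative D (Suc m) t) (at t)" for m t
  proof -
    have "(D m has_real_derivative
        (\<Sum>i\<le>n. fact m * real (i choose m) * a i * (real (i - m) * t ^ (i - m - 1)))) (at t)"
      unfolding D_def by (auto intro!: derivative_eq_intros sum.cong)
    also have "(\<Sum>i\<le>n. fact m * real (i choose m) * a i * (real (i - m) * t ^ (i - m - 1)))
        = (\<Sum>i\<le>n. (fact m * real (i choose m) * real (i - m)) * a i * t ^ (i - Suc m))"
      by (simp add: mult_ac)
    finally show ?thesis
      by (simp add: D_def[abs_def] coeff)
  qed
  \<comment> \<open>At 0 the power kills \<open>i > m\<close> and the binomial coefficient kills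
    \<open>i < m\<close>; \<open>m < k \<le> n\<close> keeps \<open>i = m\<close> in range. Hence
    the Taylor polynomial of order \<open>k\<close> at 0 is exactly the part of degree below
    \<open>k\<close>.\<close>
  have D_at_0: "D m 0 = fact m * a m" if "m < k" for m
  proof -
    have "D m 0 = (\<Sum>i\<le>n. if i = m then fact m * a m else 0)"
      unfolding D_def by (intro sum.cong) (auto simp: power_0_left binomial_eq_0)
    then show ?thesis using that assms by simp
  qed
  obtain s where s: "0 < s" "s < c"
      "D 0 c = (\<Sum>m<k. D m 0 / fact m * c ^ m) + D k s / fact k * c ^ k"
    using Maclaurin[of c k D "D 0"] assms deriv by auto
  have "(\<Sum>i\<le>n. a i * c ^ i) = (\<Sum>i<k. a i * c ^ i) + (\<Sum>i=k..n. a i * c ^ i)"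
    by (subst sum.union_disjoint[symmetric]) (use assms in \<open>auto intro: sum.cong\<close>)
  then have "(\<Sum>i=k..n. a i * c ^ i) = D k s / fact k * c ^ k"
    using s(3) by (simp add: D_at_0 D_def[of 0])
  also have "D k s / fact k = (\<Sum>i\<le>n. real (i choose k) * s ^ (i - k) * a i)"
    by (simp add: D_def sum_divide_distrib mult_ac)
  finally show ?thesis using s by blast
qed

lemma level_ge_bound:
  fixes F :: "(real^'n \<Rightarrow> real) set"
  assumes F: "F \<subseteq> boolean_functions" "closed_under_restrictions F" "f \<in> F"
    and k: "1 \<le> k" "k \<le> CARD('n)" and c: "0 < c" "c < 1" and x: "x \<in> box_of c"
  shows "\<bar>level_ge k f x\<bar> \<le> (c / (1 - c)) ^ k * fourier_sum_class k F"
proof -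
  \<comment> \<open>Rescaling to the unit box makes level \<open>i\<close> at \<open>x\<close> equal
    to \<open>c ^ i\<close> times level \<open>i\<close> at \<open>y\<close>, a polynomial in
    \<open>c\<close>.\<close>
  define y where "y = (1 / c) *\<^sub>R x"
  have x_eq: "x = c *\<^sub>R y" using c by (simp add: y_def)
  have y: "y \<in> box_of 1"
    using x c by (auto simp: y_def mem_box_cart pos_le_divide_eq pos_divide_le_eq)
  obtain s where s: "0 < s" "s < c"
    "(\<Sum>i=k..CARD('n). level i f y * c ^ i)
      = (\<Sum>i\<le>CARD('n). real (i choose k) * s ^ (i - k) * level i f y) * c ^ k"
    using polynomial_Lagrange_remainder[OF c(1) k, of "\<lambda>i. level i f y"] by blast
  define R where "R = \<bar>\<Sum>i\<le>CARD('n). real (i choose k) * s ^ (i - k) * level i f y\<bar>"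
  \<comment> \<open>The point \<open>s\<close> is unknown, but \<open>s < c\<close> makes the factor
    with \<open>c\<close> the smaller one, which leaves a bound free of \<open>s\<close>.\<close>
  have "(1 - c) ^ k * R \<le> (1 - s) ^ k * R"
    using s c by (intro mult_right_mono power_mono) (auto simp: R_def)
  also have "\<dots> \<le> fourier_sum_class k F"
    unfolding R_def by (rule taylor_coeff_bound[OF F _ _ y]) (use s c in auto)
  finally have "R \<le> fourier_sum_class k F / (1 - c) ^ k"
    using c by (simp add: field_simps)
  moreover have "level_ge k f x = (\<Sum>i=k..CARD('n). level i f y * c ^ i)"
    by (simp add: level_ge_def x_eq level_scaleR mult.commute)
  then have "\<bar>level_ge k f x\<bar> = R * c ^ k"
    using s(3) c by (simp add: abs_mult R_def)
  ultimately have "\<bar>level_ge k f x\<bar> \<le> fourier_sum_class k F / (1 - c) ^ k * c ^ k"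
    using c by (metis less_imp_le mult_right_mono zero_le_power)
  then show ?thesis
    by (simp add: power_divide mult.commute)
qed

section \<open>Approximation by polynomials of low degree\<close>

lemma sum_level_in_polys_degree_less:
  fixes f :: "real^'n \<Rightarrow> real"
  shows "(\<lambda>x. \<Sum>i<k. level i f x) \<in> polys_degree_less k"
proof -
  \<comment> \<open>\<open>e S\<close> is the 0/1 exponent vector of the monomial of
    \<open>S\<close>, with total degree \<open>card S\<close>.\<close>
  define e :: "'n set \<Rightarrow> 'n \<Rightarrow> nat" where "e S i = (if i \<in> S then 1 else 0)" for S i
  \<comment> \<open>The set where \<open>m\<close> equals 1 recovers \<open>S\<close> from
    \<open>e S\<close>. Exponent vectors that are not multilinear get coefficient 0, so the sum can
    later be extended to all vectors of degree below \<open>k\<close>.\<close>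
  define a where "a m = (if \<exists>S. m = e S then fourier_coeff f {i. m i = 1} else 0)" for m
  have e_inv: "{i. e S i = 1} = S" for S
    by (auto simp: e_def)
  have e_sum: "(\<Sum>i\<in>UNIV. e S i) = card S" for S
    by (simp add: e_def sum.If_cases)
  have e_prod: "(\<Prod>i\<in>UNIV. (x $ i) ^ e S i) = monom_set S x" for S and x :: "real^'n"
    by (simp add: e_def monom_set_def if_distrib prod.If_cases cong: if_cong)
  have "(\<Sum>i<k. level i f x)
      = (\<Sum>m | (\<Sum>i\<in>UNIV. m i) < k. a m * (\<Prod>i\<in>UNIV. (x $ i) ^ m i))" for x
  proof -
    have "(\<Sum>i<k. level i f x)
        = (\<Sum>i<k. \<Sum>S | S \<in> {S. card S < k} \<and> card S = i. fourier_coeff f S * monom_set S x)"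
      unfolding level_def by (intro sum.cong) auto
    also have "\<dots> = (\<Sum>S | card S < k. fourier_coeff f S * monom_set S x)"
      by (rule sum.group) auto
    also have "\<dots> = (\<Sum>S | card S < k. a (e S) * (\<Prod>i\<in>UNIV. (x $ i) ^ e S i))"
      unfolding a_def e_inv e_prod by (intro sum.cong) auto
    also have "\<dots> = (\<Sum>m\<in>e ` {S. card S < k}. a m * (\<Prod>i\<in>UNIV. (x $ i) ^ m i))"
    proof (subst sum.reindex)
      show "inj_on e {S. card S < k}" by (metis e_inv inj_onI)
    qed simp
    also have "\<dots> = (\<Sum>m | (\<Sum>i\<in>UNIV. m i) < k. a m * (\<Prod>i\<in>UNIV. (x $ i) ^ m i))"
      by (rule sum.mono_neutral_left) (auto simp: finite_exponents e_sum a_def)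
    finally show ?thesis .
  qed
  then show ?thesis
    unfolding polys_degree_less_def by blast
qed

lemma approx_error_le:
  fixes f :: "real^'n \<Rightarrow> real"
  assumes "g \<in> polys_degree_less k" "0 \<le> c"
  shows "approx_error c k f \<le> (SUP x \<in> box_of c. \<bar>multilinear_ext f x - g x\<bar>)"
proof -
  \<comment> \<open>This gives the lower bound 0 without which an infimum of reals need not lie
    below its members.\<close>
  have "0 \<le> (SUP x \<in> box_of c. \<bar>multilinear_ext f x - h x\<bar>)" if "h \<in> polys_degree_less k" for h
  proof -
    have "continuous_on (box_of c) (\<lambda>x. multilinear_ext f x - h x)"
      using that by (intro continuous_intros continuous_on_multilinear_ext continuous_on_poly)
    then show ?thesis
      using box_max_attained[OF assms(2)] by fastforce
  qed
  then show ?thesis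
    unfolding approx_error_def using assms(1) by (intro cINF_lower bdd_belowI2)
qed

theorem theorem3p1:
  fixes F :: "(real^'n \<Rightarrow> real) set" and f :: "real^'n \<Rightarrow> real" and k :: nat and c :: real
  assumes "F \<subseteq> boolean_functions"
    and "closed_under_restrictions F"
    and "1 \<le> k" and "k \<le> CARD('n)"
    and "f \<in> F"
    and "0 < c" and "c < 1"
  shows "(SUP x \<in> box_of c. \<bar>level_ge k f x\<bar>) \<le> (c / (1 - c)) ^ k * fourier_sum_class k F
       \<and> approx_error_class c k F \<le> (c / (1 - c)) ^ k * fourier_sum_class k F"
proof -
  have "vec 0 \<in> (box_of c :: (real^'n) set)"
    using assms(6) by (simp add: mem_box_cart)
  then have ne: "(box_of c :: (real^'n) set) \<noteq> {}" by blast
  have bound: "(SUP x \<in> box_of c. \<bar>level_ge k g x\<bar>) \<le> (c / (1 - c)) ^ k * fourier_sum_class k F"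
    if "g \<in> F" for g
    using ne level_ge_bound[OF assms(1,2) that assms(3,4,6,7)] by (rule cSUP_least)
  have "approx_error c k g \<le> (c / (1 - c)) ^ k * fourier_sum_class k F" if "g \<in> F" for g
  proof -
    \<comment> \<open>The levels below \<open>k\<close> serve as the approximating polynomial, so
      the error is exactly \<open>level_ge k g\<close>.\<close>
    have "approx_error c k g \<le> (SUP x \<in> box_of c. \<bar>multilinear_ext g x - (\<Sum>i<k. level i g x)\<bar>)"
      using sum_level_in_polys_degree_less assms(6) by (intro approx_error_le) auto
    also have "\<dots> = (SUP x \<in> box_of c. \<bar>level_ge k g x\<bar>)"
      using assms(4) by (simp add: multilinear_ext_eq_levels)
    finally show ?thesis using bound[OF that] by linarith
  qed
  moreover have "finite F"
    using assms(1) finite_boolean_functions by (rule finite_subset)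
  ultimately have "approx_error_class c k F \<le> (c / (1 - c)) ^ k * fourier_sum_class k F"
    using assms(5) unfolding approx_error_class_def by (subst Max_le_iff) auto
  then show ?thesis using bound[OF assms(5)] by blast
qed

end
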